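(* Let $L=L(a,b)$ be the free Lie ring (Lie algebra over $\mathbb{Z}$) on two letters $a,b$, and let $I_{2,m}$ be the kernel of the map $\Theta_{2,m}:L_{1,m}\oplus L_{2,m-1}\to L_{2,m}$, $\Theta_{2,m}(A,B)=[A,a]+[B,b]$. Then for every integer $m\ge 1$, $$\dim I_{2,m}=\begin{cases}0,&\text{if } m \text{ is odd},\\ 1,&\text{if } m\text{ is even}.\end{cases}$$
   Context: $L_{k,m}\subseteq L$ denotes the abelian subgroup generated by all iterated commutators in which $a$ occurs exactly $k$ times and $b$ occurs exactly $m$ times. For a free abelian group $X$, $\dim X$ denotes its rank. *)

theory Defs
  imports "HOL-Algebra.Free_Abelian_Groups"
begin

section \<open>Lie rings\<close>

class lie_ring = ab_group_add +
  fixes bracket :: "'a \<Rightarrow> 'a \<Rightarrow> 'a"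
  assumes bracket_add_left: "bracket (x + y) z = bracket x z + bracket y z"
    and bracket_add_right: "bracket x (y + z) = bracket x y + bracket x z"
    and bracket_self: "bracket x x = 0"
    and jacobi: "bracket x (bracket y z) + bracket y (bracket z x) + bracket z (bracket x y) = 0"

definition lie_hom :: "('a::lie_ring \<Rightarrow> 'b::lie_ring) \<Rightarrow> bool"
  where "lie_hom f \<longleftrightarrow>
    (\<forall>x y. f (x + y) = f x + f y) \<and> (\<forall>x y. f (bracket x y) = bracket (f x) (f y))"


section \<open>The free Lie ring on two letters\<close>

text \<open>
  The free Lie ring is constructed as the term algebra over two constants modulo the
  congruence generated by the Lie ring axioms; \<open>free_lie_universal\<close> below is its universal
  property.
\<close>

datatype lie_term =
    LetterA
  | LetterB
  | Zero
  | Neg lie_term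
  | Add lie_term lie_term
  | Br lie_term lie_term

inductive lie_eq :: "lie_term \<Rightarrow> lie_term \<Rightarrow> bool" where
  refl: "lie_eq s s"
| sym: "lie_eq s t \<Longrightarrow> lie_eq t s"
| trans: "lie_eq s t \<Longrightarrow> lie_eq t u \<Longrightarrow> lie_eq s u"
| cong_Neg: "lie_eq s s' \<Longrightarrow> lie_eq (Neg s) (Neg s')"
| cong_Add: "lie_eq s s' \<Longrightarrow> lie_eq t t' \<Longrightarrow> lie_eq (Add s t) (Add s' t')"
| cong_Br: "lie_eq s s' \<Longrightarrow> lie_eq t t' \<Longrightarrow> lie_eq (Br s t) (Br s' t')"
| add_assoc: "lie_eq (Add (Add s t) u) (Add s (Add t u))"
| add_comm: "lie_eq (Add s t) (Add t s)"
| add_zero: "lie_eq (Add Zero s) s"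
| add_neg: "lie_eq (Add (Neg s) s) Zero"
| br_add_left: "lie_eq (Br (Add s t) u) (Add (Br s u) (Br t u))"
| br_add_right: "lie_eq (Br s (Add t u)) (Add (Br s t) (Br s u))"
| br_self: "lie_eq (Br s s) Zero"
| br_jacobi: "lie_eq (Add (Add (Br s (Br t u)) (Br t (Br u s))) (Br u (Br s t))) Zero"

quotient_type free_lie = lie_term / lie_eq
  by (intro equivpI reflpI sympI transpI) (blast intro: lie_eq.refl lie_eq.sym lie_eq.trans)+

instantiation free_lie :: lie_ring
begin

lift_definition zero_free_lie :: free_lie is Zero .

lift_definition uminus_free_lie :: "free_lie \<Rightarrow> free_lie" is Neg
  by (rule lie_eq.cong_Neg)

lift_definition plus_free_lie :: "free_lie \<Rightarrow> free_lie \<Rightarrow> free_lie" is Add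
  by (rule lie_eq.cong_Add)

definition minus_free_lie :: "free_lie \<Rightarrow> free_lie \<Rightarrow> free_lie"
  where "minus_free_lie x y = x + - y"

lift_definition bracket_free_lie :: "free_lie \<Rightarrow> free_lie \<Rightarrow> free_lie" is Br
  by (rule lie_eq.cong_Br)

instance
proof
  fix x y z :: free_lie
  show "x + y + z = x + (y + z)" by transfer (rule lie_eq.add_assoc)
  show "x + y = y + x" by transfer (rule lie_eq.add_comm)
  show "0 + x = x" by transfer (rule lie_eq.add_zero)
  show "- x + x = 0" by transfer (rule lie_eq.add_neg)
  show "x - y = x + - y" by (rule minus_free_lie_def)
  show "bracket (x + y) z = bracket x z + bracket y z" by transfer (rule lie_eq.br_add_left)
  show "bracket x (y + z) = bracket x y + bracket x z" by transfer (rule lie_eq.br_add_right)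
  show "bracket x x = 0" by transfer (rule lie_eq.br_self)
  show "bracket x (bracket y z) + bracket y (bracket z x) + bracket z (bracket x y) = 0"
    by transfer (rule lie_eq.br_jacobi)
qed

end

lift_definition gen_a :: free_lie is LetterA .
lift_definition gen_b :: free_lie is LetterB .

primrec lie_eval :: "'b::lie_ring \<Rightarrow> 'b \<Rightarrow> lie_term \<Rightarrow> 'b" where
  "lie_eval x y LetterA = x"
| "lie_eval x y LetterB = y"
| "lie_eval x y Zero = 0"
| "lie_eval x y (Neg s) = - lie_eval x y s"
| "lie_eval x y (Add s t) = lie_eval x y s + lie_eval x y t"
| "lie_eval x y (Br s t) = bracket (lie_eval x y s) (lie_eval x y t)"

lemma lie_eval_cong: "lie_eq s t \<Longrightarrow> lie_eval x y s = lie_eval x y t"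
  by (induction rule: lie_eq.induct)
    (simp_all add: bracket_add_left bracket_add_right bracket_self jacobi)

lift_definition free_lie_lift :: "'b::lie_ring \<Rightarrow> 'b \<Rightarrow> free_lie \<Rightarrow> 'b" is lie_eval
  by (rule lie_eval_cong)

lemma lie_hom_zero: "lie_hom f \<Longrightarrow> f 0 = 0"
  unfolding lie_hom_def by (metis add_cancel_right_right)

lemma lie_hom_minus: "lie_hom f \<Longrightarrow> f (- x) = - f x"
  by (metis add_eq_0_iff lie_hom_def lie_hom_zero)

theorem free_lie_universal:
  fixes x y :: "'b::lie_ring"
  shows "\<exists>!f. lie_hom f \<and> f gen_a = x \<and> f gen_b = y"
proof (rule ex1I)
  show "lie_hom (free_lie_lift x y) \<and> free_lie_lift x y gen_a = x \<and> free_lie_lift x y gen_b = y"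
    unfolding lie_hom_def by (intro conjI allI; transfer; simp)
next
  fix f :: "free_lie \<Rightarrow> 'b"
  assume f: "lie_hom f \<and> f gen_a = x \<and> f gen_b = y"
  then have add: "f (u + v) = f u + f v" and br: "f (bracket u v) = bracket (f u) (f v)" for u v
    by (auto simp: lie_hom_def)
  have "f (abs_free_lie t) = lie_eval x y t" for t
  proof (induction t)
    case LetterA
    then show ?case using f by (simp add: gen_a.abs_eq)
  next
    case LetterB
    then show ?case using f by (simp add: gen_b.abs_eq)
  next
    case Zero
    then show ?case using f lie_hom_zero by (metis zero_free_lie.abs_eq lie_eval.simps(3))
  next
    case (Neg t)
    then show ?case using f lie_hom_minus by (metis uminus_free_lie.abs_eq lie_eval.simps(4))
  next
    case (Add s t)
    then show ?case by (metis add plus_free_lie.abs_eq lie_eval.simps(5))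
  next
    case (Br s t)
    then show ?case by (metis br bracket_free_lie.abs_eq lie_eval.simps(6))
  qed
  then have "f u = free_lie_lift x y u" for u
    by (induction u rule: free_lie.abs_induct) (simp add: free_lie_lift.abs_eq)
  then show "f = free_lie_lift x y" ..
qed


section \<open>Bihomogeneous components\<close>

text \<open>
  \<open>iter_comm k m x\<close>: the element \<open>x\<close> is the value of an arbitrarily bracketed iterated
  commutator in which \<open>a\<close> occurs exactly \<open>k\<close> times and \<open>b\<close> occurs exactly \<open>m\<close> times; the
  letters themselves count as commutators of length one.
\<close>

inductive iter_comm :: "nat \<Rightarrow> nat \<Rightarrow> free_lie \<Rightarrow> bool" where
  "iter_comm 1 0 gen_a"
| "iter_comm 0 1 gen_b"
| "iter_comm k m x \<Longrightarrow> iter_comm k' m' y \<Longrightarrow> iter_comm (k + k') (m + m') (bracket x y)"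

definition free_lie_group :: "free_lie monoid"
  where "free_lie_group = \<lparr>carrier = UNIV, monoid.mult = (+), one = 0\<rparr>"

definition L :: "nat \<Rightarrow> nat \<Rightarrow> free_lie monoid"
  where "L k m = subgroup_generated free_lie_group {x. iter_comm k m x}"


section \<open>Rank of free abelian groups\<close>

definition free_abelian_finite_rank :: "('a, 'c) monoid_scheme \<Rightarrow> bool"
  where "free_abelian_finite_rank G \<longleftrightarrow> (\<exists>n::nat. G \<cong> free_Abelian_group {..<n})"

text \<open>Meaningful only if \<open>free_abelian_finite_rank G\<close> holds.\<close>

definition free_rank :: "('a, 'c) monoid_scheme \<Rightarrow> nat"
  where "free_rank G = (THE n. G \<cong> free_Abelian_group {..<n})"

lemma free_rank_eqI:
  fixes G :: "('a, 'c) monoid_scheme"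
  assumes "group G" and iso: "G \<cong> free_Abelian_group {..<n::nat}"
  shows "free_rank G = n"
  unfolding free_rank_def
proof (rule the_equality)
  fix k :: nat
  assume "G \<cong> free_Abelian_group {..<k}"
  then have "free_Abelian_group {..<k} \<cong> free_Abelian_group {..<n}"
    using assms by (meson group.iso_sym iso_trans)
  then have "{..<k} \<approx> {..<n}"
    by (simp add: isomorphic_free_Abelian_groups)
  then show "k = n"
    by (simp add: eqpoll_iff_card)
qed (rule iso)


section \<open>The map \<open>\<Theta>\<^sub>2\<^sub>,\<^sub>m\<close> and its kernel\<close>

text \<open>
  The same formula defines \<open>\<Theta>\<^sub>2\<^sub>,\<^sub>m\<close> for every \<open>m\<close>; its domain and codomain are the groups
  passed to \<open>kernel\<close>. The index \<open>m - 1\<close> is a truncated subtraction, so \<open>I2 m\<close> has its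
  intended meaning for \<open>m \<ge> 1\<close> only.
\<close>

definition \<Theta> :: "free_lie \<times> free_lie \<Rightarrow> free_lie"
  where "\<Theta> = (\<lambda>(A, B). bracket A gen_a + bracket B gen_b)"

definition I2 :: "nat \<Rightarrow> (free_lie \<times> free_lie) monoid"
  where "I2 m = (L 1 m \<times>\<times> L 2 (m - 1))
    \<lparr>carrier := kernel (L 1 m \<times>\<times> L 2 (m - 1)) (L 2 m) \<Theta>\<rparr>"

lemma group_free_lie_group: "group free_lie_group"
proof (rule groupI)
  fix x assume "x \<in> carrier free_lie_group"
  show "\<exists>y\<in>carrier free_lie_group. y \<otimes>\<^bsub>free_lie_group\<^esub> x = \<one>\<^bsub>free_lie_group\<^esub>"
    by (rule bexI[of _ "- x"]) (simp_all add: free_lie_group_def)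
qed (simp_all add: free_lie_group_def add.assoc)

lemma group_L: "group (L k m)"
  unfolding L_def by (rule group.group_subgroup_generated[OF group_free_lie_group])

lemma mult_L [simp]: "x \<otimes>\<^bsub>L k m\<^esub> y = x + y"
  by (simp add: L_def free_lie_group_def)

lemma one_L [simp]: "\<one>\<^bsub>L k m\<^esub> = 0"
  by (simp add: L_def free_lie_group_def)

lemma carrier_L: "carrier (L k m) = generate free_lie_group {x. iter_comm k m x}"
  by (simp add: L_def carrier_subgroup_generated free_lie_group_def)

lemma inv_free_lie_group: "inv\<^bsub>free_lie_group\<^esub> x = - x"
  by (rule group.inv_equality[OF group_free_lie_group]) (simp_all add: free_lie_group_def)

lemma bracket_L:
  assumes "x \<in> carrier (L k m)" "iter_comm k' m' y"
  shows "bracket x y \<in> carrier (L (k + k') (m + m'))"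
  using assms(1) unfolding carrier_L
proof (induction rule: generate.induct)
  case one
  have "bracket 0 y = 0"
    using bracket_add_left[of 0 0 y] by simp
  then show ?case
    using generate.one[of free_lie_group] by (simp add: free_lie_group_def)
next
  case (incl h)
  then show ?case
    using assms(2) by (auto intro!: generate.incl iter_comm.intros(3))
next
  case (inv h)
  have "bracket (- h) y + bracket h y = bracket 0 y"
    using bracket_add_left[of "- h" h y] by simp
  also have "\<dots> = 0"
    using bracket_add_left[of 0 0 y] by simp
  finally have "bracket (- h) y = - bracket h y"
    by (simp add: eq_neg_iff_add_eq_0)
  moreover have "inv\<^bsub>free_lie_group\<^esub> (bracket h y)
      \<in> generate free_lie_group {x. iter_comm (k + k') (m + m') x}"
    using inv assms(2) by (auto intro!: generate.inv iter_comm.intros(3))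
  ultimately show ?case
    by (simp add: inv_free_lie_group)
next
  case (eng h1 h2)
  then show ?case
    using generate.eng[OF eng.IH] by (simp add: free_lie_group_def bracket_add_left)
qed

lemma \<Theta>_hom:
  assumes "m \<ge> 1"
  shows "\<Theta> \<in> hom (L 1 m \<times>\<times> L 2 (m - 1)) (L 2 m)"
proof (rule homI)
  fix p assume "p \<in> carrier (L 1 m \<times>\<times> L 2 (m - 1))"
  then obtain A B where p: "p = (A, B)" "A \<in> carrier (L 1 m)" "B \<in> carrier (L 2 (m - 1))"
    by auto
  have "bracket A gen_a \<in> carrier (L 2 m)"
    using bracket_L[OF p(2) iter_comm.intros(1)] by (simp add: numeral_2_eq_2)
  moreover have "bracket B gen_b \<in> carrier (L 2 m)"
    using bracket_L[OF p(3) iter_comm.intros(2)] assms by simp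
  ultimately show "\<Theta> p \<in> carrier (L 2 m)"
    using monoid.m_closed[OF group.is_monoid[OF group_L[of 2 m]]] by (simp add: \<Theta>_def p(1))
qed (auto simp: \<Theta>_def bracket_add_left add_ac)

end

theory Submission
  imports Defs "HOL.Modules"
begin

text \<open>
  Put \<open>e\<^sub>n = [a, b, \<dots>, b]\<close> with \<open>n\<close> letters \<open>b\<close>. The group \<open>L\<^sub>1\<^sub>,\<^sub>m\<close> is spanned by \<open>e\<^sub>m\<close>, and
  \<open>L\<^sub>2\<^sub>,\<^sub>n\<close> by the brackets \<open>[e\<^sub>i, e\<^sub>j]\<close> with \<open>i + j = n\<close> and \<open>i < j\<close>. Sending \<open>e\<^sub>n\<close> to \<open>s\<^sup>n\<close> and
  \<open>[e\<^sub>i, e\<^sub>j]\<close> to \<open>s\<^sup>i t\<^sup>j - s\<^sup>j t\<^sup>i\<close> turns the bracket with \<open>b\<close> into multiplication by \<open>s + t\<close>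
  and detects these spanning elements. A kernel element \<open>(x e\<^sub>m, B)\<close> becomes an equation
  \<open>x (s\<^sup>m - t\<^sup>m) + (s + t) P = 0\<close>: comparing coefficients shows that \<open>x\<close> determines \<open>P\<close>, and for odd
  \<open>m\<close> the substitution \<open>s = - t\<close> forces \<open>x = 0\<close>. For even \<open>m\<close> the quotient of \<open>t\<^sup>m - s\<^sup>m\<close> by
  \<open>s + t\<close> is antisymmetric and gives a kernel element with \<open>x = 1\<close>.
\<close>

section \<open>Integer multiples in abelian groups\<close>

definition zmul :: "int \<Rightarrow> 'a::ab_group_add \<Rightarrow> 'a"
  where "zmul n x = (if n \<ge> 0 then ((+) x ^^ nat n) 0 else - ((+) x ^^ nat (- n)) 0)"

lemma zmul_0 [simp]: "zmul 0 x = 0"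
  by (simp add: zmul_def)

lemma zmul_plus_1: "zmul (n + 1) x = zmul n x + x"
proof (cases "n \<ge> 0")
  case True
  then show ?thesis
    by (simp add: zmul_def nat_add_distrib add.commute)
next
  case False
  then obtain k where k: "n = - int (Suc k)"
    by (metis add.inverse_inverse neg_0_less_iff_less not_le zero_less_imp_eq_int gr0_implies_Suc)
  show ?thesis
    by (cases "k = 0") (simp_all add: k zmul_def nat_add_distrib)
qed

lemma zmul_minus_1: "zmul (n - 1) x = zmul n x - x"
  using zmul_plus_1[of "n - 1" x] by (simp add: eq_diff_eq)

lemma zmul_1 [simp]: "zmul 1 x = x"
  using zmul_plus_1[of 0 x] by simp

lemma additive_zmul:
  assumes "additive f"
  shows "f (zmul n x) = zmul n (f x)"
  by (induction n rule: int_induct[of _ 0])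
    (simp_all add: zmul_plus_1 zmul_minus_1 assms additive.zero additive.add additive.diff)

lemma zmul_add_right: "zmul n (x + y) = zmul n x + zmul n y"
  by (induction n rule: int_induct[of _ 0]) (simp_all add: zmul_plus_1 zmul_minus_1)

lemma zmul_0_right [simp]: "zmul n 0 = 0"
  by (induction n rule: int_induct[of _ 0]) (simp_all add: zmul_plus_1 zmul_minus_1)

lemma zmul_add_left: "zmul (k + n) x = zmul k x + zmul n x"
proof (induction n rule: int_induct[of _ 0])
  case (step1 i)
  then show ?case using zmul_plus_1[of "k + i" x] by (simp add: zmul_plus_1 add.assoc)
next
  case (step2 i)
  then show ?case using zmul_minus_1[of "k + i" x] by (simp add: zmul_minus_1 algebra_simps)
qed simp

lemma zmul_minus_left: "zmul (- n) x = - zmul n x"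
  using zmul_add_left[of "- n" n x] by (simp add: eq_neg_iff_add_eq_0)

lemma zmul_int [simp]: "zmul n (k :: int) = n * k"
  by (induction n rule: int_induct[of _ 0]) (simp_all add: zmul_plus_1 zmul_minus_1 algebra_simps)

section \<open>Bilinearity, antisymmetry and the derivation rule for brackets\<close>

lemma additive_bracket_left: "additive (\<lambda>x :: 'a::lie_ring. bracket x y)"
  by (simp add: additive_def bracket_add_left)

lemma additive_bracket_right: "additive (\<lambda>y :: 'a::lie_ring. bracket x y)"
  by (simp add: additive_def bracket_add_right)

lemmas bracket_0_left [simp] = additive.zero[OF additive_bracket_left]
lemmas bracket_0_right [simp] = additive.zero[OF additive_bracket_right]
lemmas bracket_minus_left = additive.minus[OF additive_bracket_left]
lemmas bracket_minus_right = additive.minus[OF additive_bracket_right]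
lemmas bracket_sum_left = additive.sum[OF additive_bracket_left]
lemmas bracket_zmul_left = additive_zmul[OF additive_bracket_left]

lemma bracket_antisym: "bracket y x = - bracket x (y :: 'a::lie_ring)"
proof -
  have "0 = bracket (x + y) (x + y)"
    by (simp add: bracket_self)
  also have "\<dots> = bracket y x + bracket x y"
    by (simp only: bracket_add_left bracket_add_right) (simp add: bracket_self)
  finally show ?thesis
    by (metis eq_neg_iff_add_eq_0)
qed

text \<open>The Jacobi identity in the form used with \<open>z = gen_b\<close>: it splits
  \<open>[[e_i, e_j], b]\<close> into \<open>[e_{i+1}, e_j] + [e_i, e_{j+1}]\<close>.\<close>

lemma bracket_derivation:
  "bracket (bracket x y) z = bracket (bracket x z) y + bracket x (bracket y (z :: 'a::lie_ring))"
proof -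
  have "bracket (bracket x y) z = - bracket z (bracket x y)"
    by (rule bracket_antisym)
  also have "\<dots> = bracket x (bracket y z) + bracket y (bracket z x)"
    using jacobi[of x y z] by (simp add: neg_eq_iff_add_eq_0 add.commute)
  also have "bracket y (bracket z x) = bracket (bracket x z) y"
    using bracket_antisym[of "bracket x z" y] by (simp add: bracket_antisym[of z x] bracket_minus_right)
  finally show ?thesis by (simp add: add.commute)
qed


section \<open>A model of the free Lie ring in degree at most two in \<open>a\<close>\<close>

text \<open>
  \<open>lin\<close> and \<open>quad\<close> hold the coefficients of power series in \<open>s\<close> and in \<open>s, t\<close>;
  bracketing with \<open>b\<close> multiplies them by \<open>s\<close> and by \<open>s + t\<close>.
\<close>

datatype elim = Elim (wt_b: int) (lin: "nat \<Rightarrow> int") (quad: "nat \<Rightarrow> nat \<Rightarrow> int")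

definition shift1 :: "(nat \<Rightarrow> int) \<Rightarrow> nat \<Rightarrow> int"
  where "shift1 f i = (case i of 0 \<Rightarrow> 0 | Suc k \<Rightarrow> f k)"

definition shift2 :: "(nat \<Rightarrow> nat \<Rightarrow> int) \<Rightarrow> nat \<Rightarrow> nat \<Rightarrow> int"
  where "shift2 g i j = (case i of 0 \<Rightarrow> 0 | Suc k \<Rightarrow> g k j) + (case j of 0 \<Rightarrow> 0 | Suc k \<Rightarrow> g i k)"

instantiation elim :: lie_ring
begin

definition zero_elim :: elim where
  "zero_elim = Elim 0 (\<lambda>_. 0) (\<lambda>_ _. 0)"

definition uminus_elim :: "elim \<Rightarrow> elim" where
  "uminus_elim x = Elim (- wt_b x) (\<lambda>i. - lin x i) (\<lambda>i j. - quad x i j)"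

definition plus_elim :: "elim \<Rightarrow> elim \<Rightarrow> elim" where
  "plus_elim x y = Elim (wt_b x + wt_b y) (\<lambda>i. lin x i + lin y i) (\<lambda>i j. quad x i j + quad y i j)"

definition minus_elim :: "elim \<Rightarrow> elim \<Rightarrow> elim" where
  "minus_elim x y = x + - y"

text \<open>Two series of degree one in \<open>a\<close> bracket to
  \<open>f(s) g(t) - g(s) f(t)\<close>, \<open>b\<close> acts as a derivation, and all terms of
  higher degree in \<open>a\<close> are dropped.\<close>

definition bracket_elim :: "elim \<Rightarrow> elim \<Rightarrow> elim" where
  "bracket_elim x y = Elim 0
    (\<lambda>i. wt_b y * shift1 (lin x) i - wt_b x * shift1 (lin y) i)
    (\<lambda>i j. lin x i * lin y j - lin y i * lin x j
      + wt_b y * shift2 (quad x) i j - wt_b x * shift2 (quad y) i j)"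

instance
proof
  fix x y z :: elim
  note defs = zero_elim_def uminus_elim_def plus_elim_def minus_elim_def bracket_elim_def
    shift1_def shift2_def fun_eq_iff
  show "x + y + z = x + (y + z)" "x + y = y + x" "0 + x = x" "- x + x = 0" "x - y = x + - y"
    by (simp_all add: defs)
  show "bracket (x + y) z = bracket x z + bracket y z" "bracket x (y + z) = bracket x y + bracket x z"
    "bracket x x = 0"
    by (simp_all add: defs algebra_simps split: nat.splits)
  show "bracket x (bracket y z) + bracket y (bracket z x) + bracket z (bracket x y) = 0"
    by (simp add: defs algebra_simps split: nat.splits)
qed

end

definition to_elim :: "free_lie \<Rightarrow> elim"
  where "to_elim = free_lie_lift (Elim 0 (\<lambda>i. of_bool (i = 0)) (\<lambda>_ _. 0)) (Elim 1 (\<lambda>_. 0) (\<lambda>_ _. 0))"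

lemma to_elim_simps:
  "to_elim gen_a = Elim 0 (\<lambda>i. of_bool (i = 0)) (\<lambda>_ _. 0)"
  "to_elim gen_b = Elim 1 (\<lambda>_. 0) (\<lambda>_ _. 0)"
  "to_elim (x + y) = to_elim x + to_elim y"
  "to_elim (bracket x y) = bracket (to_elim x) (to_elim y)"
  unfolding to_elim_def by (transfer; simp)+

definition lin_coeff :: "nat \<Rightarrow> free_lie \<Rightarrow> int"
  where "lin_coeff i x = lin (to_elim x) i"

definition quad_coeff :: "nat \<Rightarrow> nat \<Rightarrow> free_lie \<Rightarrow> int"
  where "quad_coeff i j x = quad (to_elim x) i j"

lemma additive_lin_coeff: "additive (lin_coeff i)"
  by (simp add: additive_def lin_coeff_def to_elim_simps plus_elim_def)

lemma additive_quad_coeff: "additive (quad_coeff i j)"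
  by (simp add: additive_def quad_coeff_def to_elim_simps plus_elim_def)

text \<open>The letter \<open>a\<close> is the constant series 1, so these are the coefficients of
  \<open>f(s) - f(t)\<close>, where \<open>f\<close> is the linear part of \<open>x\<close>.\<close>

lemma quad_coeff_bracket_a:
  "quad_coeff i j (bracket x gen_a) = lin_coeff i x * of_bool (j = 0) - of_bool (i = 0) * lin_coeff j x"
  by (simp add: lin_coeff_def quad_coeff_def to_elim_simps bracket_elim_def shift2_def split: nat.splits)

lemma quad_coeff_bracket_b:
  "quad_coeff i j (bracket x gen_b) =
    (case i of 0 \<Rightarrow> 0 | Suc k \<Rightarrow> quad_coeff k j x) + (case j of 0 \<Rightarrow> 0 | Suc k \<Rightarrow> quad_coeff i k x)"
  by (simp add: quad_coeff_def to_elim_simps bracket_elim_def shift2_def split: nat.splits)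


section \<open>Spanning sets\<close>

primrec ad_b :: "nat \<Rightarrow> free_lie" where
  "ad_b 0 = gen_a"
| "ad_b (Suc n) = bracket (ad_b n) gen_b"

lemma to_elim_ad_b: "to_elim (ad_b n) = Elim 0 (\<lambda>i. of_bool (i = n)) (\<lambda>_ _. 0)"
  by (induction n)
    (auto simp: to_elim_simps bracket_elim_def shift1_def shift2_def fun_eq_iff split: nat.splits)

lemma lin_coeff_ad_b: "lin_coeff i (ad_b n) = of_bool (i = n)"
  by (simp add: lin_coeff_def to_elim_ad_b)

lemma quad_coeff_ad_b:
  "quad_coeff i j (bracket (ad_b k) (ad_b l)) =
    of_bool (i = k \<and> j = l) - of_bool (i = l \<and> j = k)"
  unfolding quad_coeff_def to_elim_simps(4) to_elim_ad_b bracket_elim_def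
  by (simp add: of_bool_conj)

text \<open>A projection onto the span of the \<open>[e\<^sub>i, e\<^sub>j]\<close> with \<open>i < j\<close>; it will be the identity on \<open>L\<^sub>2\<^sub>,\<^sub>n\<close>.\<close>

definition quad_part :: "nat \<Rightarrow> free_lie \<Rightarrow> free_lie"
  where "quad_part n x =
    (\<Sum>i | 2 * i < n. zmul (quad_coeff i (n - i) x) (bracket (ad_b i) (ad_b (n - i))))"

lemma finite_double_less [simp]: "finite {i::nat. 2 * i < n}"
  by (rule finite_subset[of _ "{..<n}"]) auto

lemma additive_quad_part: "additive (quad_part n)"
  by (rule additive.intro)
    (simp only: quad_part_def additive.add[OF additive_quad_coeff] zmul_add_left sum.distrib)

lemma quad_part_ad_b_less:
  assumes "i < j"
  shows "quad_part (i + j) (bracket (ad_b i) (ad_b j)) = bracket (ad_b i) (ad_b j)"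
proof -
  have "quad_part (i + j) (bracket (ad_b i) (ad_b j)) =
    (\<Sum>k | 2 * k < i + j. if k = i then bracket (ad_b i) (ad_b j) else 0)"
    \<comment> \<open>In the range \<open>2 * k < i + j\<close> only \<open>k = i\<close>
      contributes, as \<open>k = j\<close> would contradict \<open>i < j\<close>.\<close>
    unfolding quad_part_def by (rule sum.cong) (use assms in \<open>auto simp: quad_coeff_ad_b\<close>)
  also have "\<dots> = bracket (ad_b i) (ad_b j)"
    using assms by simp
  finally show ?thesis .
qed

lemma quad_part_ad_b: "quad_part (i + j) (bracket (ad_b i) (ad_b j)) = bracket (ad_b i) (ad_b j)"
proof (cases i j rule: linorder_cases)
  case greater
  then show ?thesis
    using quad_part_ad_b_less[of j i]
    by (simp add: bracket_antisym[of "ad_b i"] additive.minus[OF additive_quad_part] add.commute)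
qed (simp_all add: quad_part_ad_b_less bracket_self additive.zero[OF additive_quad_part])

text \<open>By the derivation rule, bracketing a spanning element with \<open>b\<close> gives a sum
  of two brackets of the same shape, each fixed by the projection; the rest is linearity.\<close>

lemma quad_part_bracket_b:
  assumes "quad_part n x = x"
  shows "quad_part (Suc n) (bracket x gen_b) = bracket x gen_b"
proof -
  have "quad_part (Suc n) (bracket (bracket (ad_b i) (ad_b (n - i))) gen_b) =
    bracket (bracket (ad_b i) (ad_b (n - i))) gen_b" if "2 * i < n" for i
    using that quad_part_ad_b[of "Suc i" "n - i"] quad_part_ad_b[of i "Suc (n - i)"]
    by (simp add: bracket_derivation[of _ _ gen_b] additive.add[OF additive_quad_part])
  then have "quad_part (Suc n) (bracket (quad_part n x) gen_b) = bracket (quad_part n x) gen_b"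
    unfolding quad_part_def[of n]
    by (auto simp: bracket_sum_left bracket_zmul_left additive.sum[OF additive_quad_part]
        additive_zmul[OF additive_quad_part] intro!: sum.cong)
  then show ?thesis
    by (simp add: assms)
qed

text \<open>The three degrees need one simultaneous induction, since degree 2 in \<open>a\<close>
  arises as 1 + 1, 2 + 0 or 0 + 2. Signs enter through \<open>[b, e_m] = - e_{m+1}\<close>.\<close>

lemma iter_comm_low:
  assumes "iter_comm k m x"
  shows "(k = 0 \<longrightarrow> x = 0 \<or> m = 1 \<and> x = gen_b)
    \<and> (k = 1 \<longrightarrow> x = 0 \<or> x = ad_b m \<or> x = - ad_b m)
    \<and> (k = 2 \<longrightarrow> quad_part m x = x)"
  using assms
proof (induction rule: iter_comm.induct)
  case (3 k m x k' m' y)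
  have neg: "quad_part (Suc m) (bracket gen_b x) = bracket gen_b x" if "quad_part m x = x" for m x
    using quad_part_bracket_b[OF that]
    by (simp add: bracket_antisym[of gen_b] additive.minus[OF additive_quad_part])
  \<comment> \<open>In the last case no claim remains.\<close>
  consider "k = 0" "k' = 0" | "k = 0" "k' = 1" | "k = 1" "k' = 0" | "k = 0" "k' = 2"
    | "k = 1" "k' = 1" | "k = 2" "k' = 0" | "k + k' > 2"
    by linarith
  then show ?case
    by cases (use 3 quad_part_bracket_b[of m x] neg[of m' y] quad_part_ad_b[of m m'] in
      \<open>auto simp: bracket_self bracket_minus_left bracket_minus_right bracket_antisym[of gen_b]
        additive.zero[OF additive_quad_part] additive.minus[OF additive_quad_part]\<close>)
qed simp_all

lemma L_induct [consumes 1, case_names zero incl minus add]: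
  assumes "x \<in> carrier (L k m)"
    and "P 0" "\<And>x. iter_comm k m x \<Longrightarrow> P x" "\<And>x. P x \<Longrightarrow> P (- x)"
    and "\<And>x y. P x \<Longrightarrow> P y \<Longrightarrow> P (x + y)"
  shows "P x"
  using assms(1) unfolding carrier_L
proof (induction rule: generate.induct)
  case one
  then show ?case using assms(2) by (simp add: free_lie_group_def)
next
  case (inv h)
  then show ?case using assms(3,4) by (simp add: inv_free_lie_group)
next
  case (eng h1 h2)
  then show ?case using assms(5) by (simp add: free_lie_group_def)
qed (use assms(3) in auto)

lemma L_1_eq:
  assumes "x \<in> carrier (L 1 m)"
  shows "x = zmul (lin_coeff m x) (ad_b m)"
  using assms
proof (induction rule: L_induct)
  case (incl x)
  then show ?case
    using iter_comm_low[OF incl]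
    by (auto simp: additive.zero[OF additive_lin_coeff] additive.minus[OF additive_lin_coeff]
        lin_coeff_ad_b zmul_minus_left)
qed (simp_all add: additive.zero[OF additive_lin_coeff] additive.minus[OF additive_lin_coeff]
    additive.add[OF additive_lin_coeff] zmul_minus_left zmul_add_left)

text \<open>As \<open>quad_part\<close> sees only coefficients, those in the model determine every
  element of \<open>L 2 m\<close>.\<close>

lemma L_2_eq:
  assumes "x \<in> carrier (L 2 m)"
  shows "quad_part m x = x"
  using assms
proof (induction rule: L_induct)
  case (incl x)
  then show ?case
    using iter_comm_low[OF incl] by simp
qed (simp_all add: additive.zero[OF additive_quad_part] additive.minus[OF additive_quad_part]
    additive.add[OF additive_quad_part])

section \<open>Closure properties of the groups \<open>L k m\<close>\<close>

lemma L_zero: "0 \<in> carrier (L k m)"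
  using monoid.one_closed[OF group.is_monoid[OF group_L[of k m]]] by simp

lemma L_add: "x \<in> carrier (L k m) \<Longrightarrow> y \<in> carrier (L k m) \<Longrightarrow> x + y \<in> carrier (L k m)"
  using monoid.m_closed[OF group.is_monoid[OF group_L[of k m]]] by simp

lemma L_minus:
  assumes "x \<in> carrier (L k m)"
  shows "- x \<in> carrier (L k m)"
proof -
  have "inv\<^bsub>L k m\<^esub> x + x = 0" "inv\<^bsub>L k m\<^esub> x \<in> carrier (L k m)"
    using group.l_inv[OF group_L assms] group.inv_closed[OF group_L assms] by simp_all
  then show ?thesis
    by (metis add_eq_0_iff2)
qed

lemma L_diff: "x \<in> carrier (L k m) \<Longrightarrow> y \<in> carrier (L k m) \<Longrightarrow> x - y \<in> carrier (L k m)"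
  using L_add[of x k m "- y"] L_minus[of y k m] by simp

lemma L_zmul: "x \<in> carrier (L k m) \<Longrightarrow> zmul n x \<in> carrier (L k m)"
  by (induction n rule: int_induct[of _ 0])
    (simp_all add: L_zero L_add L_diff zmul_plus_1 zmul_minus_1)

lemma L_sum: "(\<And>i. i \<in> I \<Longrightarrow> f i \<in> carrier (L k m)) \<Longrightarrow> sum f I \<in> carrier (L k m)"
  by (induction I rule: infinite_finite_induct) (simp_all add: L_zero L_add)

lemma L_incl: "iter_comm k m x \<Longrightarrow> x \<in> carrier (L k m)"
  by (simp add: carrier_L generate.incl)

lemma iter_comm_ad_b: "iter_comm 1 n (ad_b n)"
  by (induction n) (use iter_comm.intros in \<open>force+\<close>)

lemma bracket_ad_b_in_L: "bracket (ad_b i) (ad_b j) \<in> carrier (L 2 (i + j))"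
  using iter_comm.intros(3)[OF iter_comm_ad_b iter_comm_ad_b] by (intro L_incl) (simp add: numeral_2_eq_2)


section \<open>The kernel of \<open>\<Theta>\<close>\<close>

lemma kernel_quad_coeff:
  assumes m: "m \<ge> 1" and A: "A \<in> carrier (L 1 m)" and \<Theta>: "\<Theta> (A, B) = 0"
  shows "i < m \<Longrightarrow> quad_coeff i (m - 1 - i) B = (- 1) ^ i * lin_coeff m A"
    and "odd m \<Longrightarrow> lin_coeff m A = 0"
proof -
  have A0: "lin_coeff j A = 0" if "j \<noteq> m" for j
    by (subst L_1_eq[OF A]) (simp add: additive_zmul[OF additive_lin_coeff] lin_coeff_ad_b that)
  have eq: "quad_coeff i j (bracket A gen_a) + quad_coeff i j (bracket B gen_b) = 0" for i j
    using arg_cong[OF \<Theta>, of "quad_coeff i j"]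
    by (simp add: \<Theta>_def additive.add[OF additive_quad_coeff] additive.zero[OF additive_quad_coeff])
  note eq = eq[unfolded quad_coeff_bracket_a quad_coeff_bracket_b]
  have coeff: "quad_coeff i (m - 1 - i) B = (- 1) ^ i * lin_coeff m A" if "i < m" for i
    using that
  proof (induction i)
    case 0
    then show ?case
      \<comment> \<open>The coefficient of \<open>t^m\<close> starts the recursion; the mixed ones
        then make consecutive coefficients of \<open>B\<close> opposite.\<close>
      using eq[of 0 m] by (auto split: nat.splits)
  next
    case (Suc i)
    then have "m - 1 - i = Suc (m - 1 - Suc i)"
      by simp
    then show ?case
      using eq[of "Suc i" "m - 1 - i"] Suc A0[of "Suc i"] by simp
  qed
  then show "i < m \<Longrightarrow> quad_coeff i (m - 1 - i) B = (- 1) ^ i * lin_coeff m A" .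
  assume "odd m"
  \<comment> \<open>With \<open>x = lin_coeff m A\<close>, the coefficient of \<open>s^m\<close>
    gives \<open>x + (-1)^(m-1) x = 0\<close>, hence \<open>2 x = 0\<close> for odd
    \<open>m\<close>.\<close>
  then show "lin_coeff m A = 0"
    using eq[of m 0] coeff[of "m - 1"] m A0[of 0] by (cases m) auto
qed

lemma kernel_eq_0:
  assumes m: "m \<ge> 1" and A: "A \<in> carrier (L 1 m)" and B: "B \<in> carrier (L 2 (m - 1))"
    and "\<Theta> (A, B) = 0" "lin_coeff m A = 0"
  shows "A = 0" "B = 0"
proof -
  show "A = 0"
    using L_1_eq[OF A] assms by simp
  have "quad_part (m - 1) B = 0"
    unfolding quad_part_def
    by (rule sum.neutral) (use kernel_quad_coeff(1)[OF m A, of B] assms in auto)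
  then show "B = 0"
    using L_2_eq[OF B] by simp
qed

text \<open>The quotient of \<open>t^(2h) - s^(2h)\<close> by \<open>s + t\<close> is the sum of
  \<open>(-1)^i s^i t^(2h-1-i)\<close> over \<open>i < 2h\<close>; pairing \<open>i\<close> with
  \<open>2h-1-i\<close> leaves the brackets with \<open>i < h\<close>.\<close>

definition kernel_gen :: "nat \<Rightarrow> free_lie"
  where "kernel_gen h = (\<Sum>i<h. zmul ((- 1) ^ i) (bracket (ad_b i) (ad_b (2 * h - 1 - i))))"

lemma kernel_gen_in_L: "kernel_gen h \<in> carrier (L 2 (2 * h - 1))"
  unfolding kernel_gen_def
proof (intro L_sum L_zmul)
  fix i assume "i \<in> {..<h}"
  then show "bracket (ad_b i) (ad_b (2 * h - 1 - i)) \<in> carrier (L 2 (2 * h - 1))"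
    using bracket_ad_b_in_L[of i "2 * h - 1 - i"] by simp
qed

lemma \<Theta>_kernel_gen: "\<Theta> (ad_b (2 * h), kernel_gen h) = 0"
proof -
  \<comment> \<open>The partial sums telescope. At \<open>k = h\<close> the remainder is a multiple
    of \<open>[e_h, e_h] = 0\<close>, and \<open>[a, e_{2h}]\<close> cancels
    \<open>[e_{2h}, a]\<close>.\<close>
  have "bracket (\<Sum>i<k. zmul ((- 1) ^ i) (bracket (ad_b i) (ad_b (2 * h - 1 - i)))) gen_b =
    bracket gen_a (ad_b (2 * h)) - zmul ((- 1) ^ k) (bracket (ad_b k) (ad_b (2 * h - k)))"
    if "k \<le> h" for k
    using that
  proof (induction k)
    case (Suc k)
    then have "2 * h - k = Suc (2 * h - Suc k)"
      by simp
    moreover have "bracket (bracket (ad_b k) (ad_b (2 * h - 1 - k))) gen_b =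
        bracket (ad_b (Suc k)) (ad_b (2 * h - Suc k)) + bracket (ad_b k) (ad_b (Suc (2 * h - Suc k)))"
      by (simp add: bracket_derivation[of _ _ gen_b])
    ultimately show ?case
      using Suc by (simp add: bracket_add_left bracket_zmul_left zmul_add_right zmul_minus_left)
  qed simp
  from this[of h] show ?thesis
    by (simp add: \<Theta>_def kernel_gen_def bracket_self bracket_antisym[of gen_a] additive_zmul
        mult_2)
qed

section \<open>The kernel as a group and its rank\<close>

lemma \<Theta>_add: "\<Theta> (A + A', B + B') = \<Theta> (A, B) + \<Theta> (A', B')"
  by (simp add: \<Theta>_def bracket_add_left)

lemma carrier_I2:
  "carrier (I2 m) = {(A, B). A \<in> carrier (L 1 m) \<and> B \<in> carrier (L 2 (m - 1)) \<and> \<Theta> (A, B) = 0}"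
  by (auto simp: I2_def kernel_def)

lemma mult_I2: "(A, B) \<otimes>\<^bsub>I2 m\<^esub> (A', B') = (A + A', B + B')"
  by (simp add: I2_def)

lemma group_I2:
  assumes "m \<ge> 1"
  shows "group (I2 m)"
proof -
  interpret group_hom "L 1 m \<times>\<times> L 2 (m - 1)" "L 2 m" \<Theta>
    by (intro group_hom.intro group_hom_axioms.intro DirProd_group group_L) (rule \<Theta>_hom[OF assms])
  show ?thesis
    unfolding I2_def by (rule subgroup.subgroup_is_group[OF subgroup_kernel G.group_axioms])
qed

lemma frag_eq_cmul_of:
  assumes "Poly_Mapping.keys c \<subseteq> {a}"
  shows "frag_cmul (poly_mapping.lookup c a) (frag_of a) = c"
  using assms by (intro poly_mapping_eqI) (auto simp: lookup_single in_keys_iff when_def)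

theorem proposition1p4:
  fixes m :: nat
  assumes "m \<ge> 1"
  shows "free_abelian_finite_rank (I2 m) \<and> free_rank (I2 m) = (if odd m then 0 else 1)"
proof -
  define r :: nat where "r = (if odd m then 0 else 1)"
  \<comment> \<open>A kernel element is recorded by its coefficient at \<open>e_m\<close>, which is
    zero for odd \<open>m\<close>, so that the values lie in the trivial group when
    \<open>r = 0\<close>.\<close>
  define F where "F = (\<lambda>(A, B :: free_lie). frag_cmul (lin_coeff m A) (frag_of (0::nat)))"
  have hom: "F \<in> hom (I2 m) (free_Abelian_group {..<r})"
  proof (rule homI)
    fix p assume "p \<in> carrier (I2 m)"
    then show "F p \<in> carrier (free_Abelian_group {..<r})"
      using kernel_quad_coeff(2)[OF assms] by (auto simp: carrier_I2 F_def r_def)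
  next
    fix p q
    show "F (p \<otimes>\<^bsub>I2 m\<^esub> q) = F p \<otimes>\<^bsub>free_Abelian_group {..<r}\<^esub> F q"
      by (cases p; cases q)
        (simp add: mult_I2 F_def additive.add[OF additive_lin_coeff] frag_cmul_distrib)
  qed
  have inj: "inj_on F (carrier (I2 m))"
  proof (rule inj_onI)
    fix p q assume p: "p \<in> carrier (I2 m)" and q: "q \<in> carrier (I2 m)" and "F p = F q"
    obtain A B A' B' where pq: "p = (A, B)" "q = (A', B')"
      by (cases p; cases q)
    have "lin_coeff m A = lin_coeff m A'"
      using arg_cong[OF \<open>F p = F q\<close>, of "\<lambda>c. poly_mapping.lookup c 0"] by (simp add: F_def pq)
    moreover have "\<Theta> (A - A', B - B') = 0"
      using p q \<Theta>_add[of "A - A'" A' "B - B'" B'] by (simp add: pq carrier_I2)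
    ultimately have "A - A' = 0 \<and> B - B' = 0"
      using p q kernel_eq_0[OF assms, of "A - A'" "B - B'"]
      by (simp add: pq carrier_I2 L_diff L_zero additive.zero[OF additive_lin_coeff]
          additive.diff[OF additive_lin_coeff])
    then show "p = q"
      by (simp add: pq)
  qed
  have surj: "c \<in> F ` carrier (I2 m)" if c: "c \<in> carrier (free_Abelian_group {..<r})" for c
  proof (cases "odd m")
    case True
    then have "c = F (0, 0)"
      using c by (simp add: r_def F_def additive.zero[OF additive_lin_coeff])
    then show ?thesis
      by (auto simp: carrier_I2 L_zero \<Theta>_def)
  next
    case False
    then obtain h where h: "m = 2 * h" by blast
    define n where "n = poly_mapping.lookup c 0"
    let ?p = "(zmul n (ad_b m), zmul n (kernel_gen h))"
    have "Poly_Mapping.keys c \<subseteq> {0}"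
      using c by (auto simp: r_def h)
    then have "c = F ?p"
      using frag_eq_cmul_of[of c 0]
      by (simp add: F_def n_def additive_zmul[OF additive_lin_coeff] lin_coeff_ad_b)
    moreover have "\<Theta> ?p = zmul n (\<Theta> (ad_b m, kernel_gen h))"
      by (simp add: \<Theta>_def bracket_zmul_left zmul_add_right)
    then have "?p \<in> carrier (I2 m)"
      using kernel_gen_in_L[of h] L_incl[OF iter_comm_ad_b] \<Theta>_kernel_gen[of h]
      by (simp add: carrier_I2 h L_zmul)
    ultimately show ?thesis by blast
  qed
  have "F \<in> iso (I2 m) (free_Abelian_group {..<r})"
    using hom inj surj by (auto simp: iso_def bij_betw_def hom_def)
  then have "I2 m \<cong> free_Abelian_group {..<r}"
    by (auto simp: is_iso_def)
  then show ?thesis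
    using free_rank_eqI[OF group_I2[OF assms]] by (auto simp: free_abelian_finite_rank_def r_def)
qed

end
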